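(* Let $(X,\tau)$ be a compact sober $T_1$-space which is locally compact or sequential. Then $\tau$ is the infimum (in the lattice of topologies on $X$ ordered by inclusion) of a family of maximal compact topologies on $X$.
   Context: Compactness means that every open cover has a finite subcover; no separation axiom is included. A nonempty subspace $S$ of a topological space is called irreducible if each pair of nonempty open sets of $S$ intersects. A topological space is called sober if every irreducible closed set is the closure of some unique singleton. A topological space is called locally compact if each of its points has a neighborhood base consisting of compact sets. A topological space $X$ is called sequential if a set $A\subseteq X$ is closed if and only if together with any sequence it contains all its limits in $X$. A compact topology on a set $X$ is called maximal compact if it is not strictly contained in any compact topology on $X$. The infimum of a family of topologies on $X$ is their intersection. *)

theory Defs
  imports "HOL-Analysis.Analysis"
begin

definition irreducible_in :: "'a topology \<Rightarrow> 'a set \<Rightarrow> bool" where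
  "irreducible_in X S \<longleftrightarrow> S \<subseteq> topspace X \<and> S \<noteq> {} \<and>
     (\<forall>U V. openin (subtopology X S) U \<and> openin (subtopology X S) V \<and> U \<noteq> {} \<and> V \<noteq> {}
        \<longrightarrow> U \<inter> V \<noteq> {})"

definition sober_space :: "'a topology \<Rightarrow> bool" where
  "sober_space X \<longleftrightarrow> (\<forall>S. closedin X S \<and> irreducible_in X S
     \<longrightarrow> (\<exists>!x. x \<in> topspace X \<and> S = X closure_of {x}))"

definition sequential_space :: "'a topology \<Rightarrow> bool" where
  "sequential_space X \<longleftrightarrow> (\<forall>A. A \<subseteq> topspace X \<longrightarrow>
     (closedin X A \<longleftrightarrow>
       (\<forall>f :: nat \<Rightarrow> 'a. \<forall>l. range f \<subseteq> A \<and> limitin X f l sequentially \<longrightarrow> l \<in> A)))"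

text \<open>Local compactness in the strong sense: every point has a neighbourhood base of compact
  sets. Without the Hausdorff property this is stronger than \<^const>\<open>locally_compact_space\<close>, which
  only asks for one compact neighbourhood of each point.\<close>

definition locally_compact_base_space :: "'a topology \<Rightarrow> bool" where
  "locally_compact_base_space X \<longleftrightarrow> neighbourhood_base_of (compactin X) X"

definition maximal_compact_topology_on :: "'a set \<Rightarrow> 'a topology \<Rightarrow> bool" where
  "maximal_compact_topology_on S X \<longleftrightarrow> topspace X = S \<and> compact_space X \<and>
     \<not> (\<exists>Y. topspace Y = S \<and> compact_space Y \<and> Collect (openin X) \<subset> Collect (openin Y))"

text \<open>The guard \<open>U \<subseteq> S\<close> matters only for the empty family, whose infimum is the discrete
  topology on \<open>S\<close>.\<close>

definition inf_topology_on :: "'a set \<Rightarrow> 'a topology set \<Rightarrow> 'a topology" where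
  "inf_topology_on S F = topology (\<lambda>U. U \<subseteq> S \<and> (\<forall>X\<in>F. openin X U))"

lemma openin_inf_topology_on:
  "openin (inf_topology_on S F) U \<longleftrightarrow> U \<subseteq> S \<and> (\<forall>X\<in>F. openin X U)"
proof -
  have "istopology (\<lambda>U. U \<subseteq> S \<and> (\<forall>X\<in>F. openin X U))"
    unfolding istopology_def by (blast intro: openin_Int openin_Union)
  then show ?thesis
    by (simp add: inf_topology_on_def topology_inverse')
qed

lemma topspace_inf_topology_on:
  assumes "\<And>X. X \<in> F \<Longrightarrow> topspace X = S"
  shows "topspace (inf_topology_on S F) = S"
proof
  show "topspace (inf_topology_on S F) \<subseteq> S"
    using openin_topspace[of "inf_topology_on S F"] unfolding openin_inf_topology_on by simp
  have "openin (inf_topology_on S F) S"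
    unfolding openin_inf_topology_on by (metis assms openin_topspace subset_refl)
  then show "S \<subseteq> topspace (inf_topology_on S F)"
    by (rule openin_subset)
qed

end

theory Submission
  imports Defs
begin

text \<open>
  Call a topology \<open>\<rho>\<close> on \<open>X\<close> finer than \<open>\<tau>\<close> if every \<open>\<tau>\<close>-open set is \<open>\<rho>\<close>-open. Everything rests
  on one property of a sober \<open>T\<^sub>1\<close> space: a filtered family of nonempty compact sets has a common
  point (\<open>filtered_compact_Inter_nonempty\<close>). In a Hausdorff space this is clear because compact sets
  are closed; here sobriety takes over the role of closedness.

  The first consequence is that compact topologies finer than \<open>\<tau>\<close> satisfy the hypothesis of Zorn's
  lemma. A set that is closed in a compact topology finer than \<open>\<tau>\<close> is \<open>\<tau>\<close>-compact, so in the
  topology generated by a directed family of such topologies, a failure of compactness would be a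
  filtered family of nonempty \<open>\<tau>\<close>-compact sets without a common point. Hence every compact topology
  finer than \<open>\<tau>\<close> lies below a maximal compact one (\<open>maximal_compact_topology_above\<close>).

  The second consequence is that, if \<open>\<tau>\<close> is locally compact or sequential, a set \<open>A\<close> whose trace on
  every compact set is compact must be closed. If \<open>x\<close> is a limit outside \<open>A\<close> of a sequence in \<open>A\<close>,
  the tails of the sequence are the traces of the compact sets \<open>tail \<union> {x}\<close>; if \<open>x\<close> is in
  the closure of \<open>A\<close> and has a base of compact neighbourhoods, consider the traces of those.
  In both cases the traces are filtered, so they have a common point, which lies in \<open>A\<close> and which \<open>T\<^sub>1\<close> forces to be \<open>x\<close>.

  The family wanted consists of all maximal compact topologies finer than \<open>\<tau>\<close>. Suppose that \<open>A\<close> is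
  closed in each of them, and let \<open>K\<close> be \<open>\<tau>\<close>-compact. Declaring \<open>K\<close> closed keeps \<open>\<tau>\<close> compact, so
  \<open>K\<close> is closed in some member of the family; there \<open>A \<inter> K\<close> is closed too, hence it is
  \<open>\<tau>\<close>-compact. By the second consequence \<open>A\<close> is \<open>\<tau>\<close>-closed.
\<close>

section \<open>Filtered families of compact sets\<close>

text \<open>
  Since the members are compact, Zorn's lemma provides a minimal closed set \<open>S\<close> meeting all of them.
  Filteredness makes \<open>S\<close> irreducible: each closed proper part of \<open>S\<close> misses a member, so if two such
  parts covered \<open>S\<close>, then a third member below the two missed ones would not meet \<open>S\<close>. By sobriety
  and \<open>T\<^sub>1\<close>, \<open>S\<close> is a singleton, whose point then belongs to every member. The proof works with the
  complement \<open>M\<close> of \<open>S\<close>, a maximal open set that contains no member.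
\<close>

lemma filtered_compact_Inter_nonempty:
  assumes sober: "sober_space \<tau>" and t1: "t1_space \<tau>"
    and "\<K> \<noteq> {}"
    and comp: "\<And>K. K \<in> \<K> \<Longrightarrow> compactin \<tau> K"
    and ne: "\<And>K. K \<in> \<K> \<Longrightarrow> K \<noteq> {}"
    and filt: "\<And>K L. \<lbrakk>K \<in> \<K>; L \<in> \<K>\<rbrakk> \<Longrightarrow> \<exists>M\<in>\<K>. M \<subseteq> K \<inter> L"
  shows "\<Inter>\<K> \<noteq> {}"
proof -
  define \<A> where "\<A> = {U. openin \<tau> U \<and> (\<forall>K\<in>\<K>. \<not> K \<subseteq> U)}"
  have "\<exists>M\<in>\<A>. \<forall>U\<in>\<A>. M \<subseteq> U \<longrightarrow> U = M"
  proof (rule subset_Zorn_nonempty)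
    have "{} \<in> \<A>"
      using ne by (auto simp: \<A>_def)
    then show "\<A> \<noteq> {}" by blast
  next
    fix \<C> assume "\<C> \<noteq> {}" and chain: "subset.chain \<A> \<C>"
    then have sub: "\<C> \<subseteq> \<A>"
      by (simp add: subset.chain_def)
    have "\<not> K \<subseteq> \<Union>\<C>" if K: "K \<in> \<K>" for K
    proof
      assume cover: "K \<subseteq> \<Union>\<C>"
      have "\<exists>\<F>. finite \<F> \<and> \<F> \<subseteq> \<C> \<and> K \<subseteq> \<Union>\<F>"
        using sub by (intro compactinD[OF comp[OF K] _ cover]) (auto simp: \<A>_def)
      then obtain \<F> where \<F>: "finite \<F>" "\<F> \<subseteq> \<C>" "K \<subseteq> \<Union>\<F>"
        by blast
      then have "\<F> \<noteq> {}"
        using ne[OF K] by auto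
      moreover have "subset.chain \<A> \<F>"
        using chain \<F>(2) unfolding subset_chain_def by (meson subset_iff)
      ultimately have "\<Union>\<F> \<in> \<F>"
        using Union_in_chain \<F>(1) by blast
      then show False
        using sub \<F> K by (auto simp: \<A>_def)
    qed
    then show "\<Union>\<C> \<in> \<A>"
      using sub by (auto simp: \<A>_def)
  qed
  then obtain M where "M \<in> \<A>" and max: "\<And>U. \<lbrakk>U \<in> \<A>; M \<subseteq> U\<rbrakk> \<Longrightarrow> U = M"
    by blast
  then have M: "openin \<tau> M" "\<And>K. K \<in> \<K> \<Longrightarrow> \<not> K \<subseteq> M"
    by (auto simp: \<A>_def)
  define S where "S = topspace \<tau> - M"
  have K_top: "K \<subseteq> topspace \<tau>" if "K \<in> \<K>" for K
    using comp[OF that] by (rule compactin_subset_topspace)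
  have grow: "\<exists>K\<in>\<K>. K \<subseteq> M \<union> U" if "openin \<tau> U" "U \<inter> S \<noteq> {}" for U
  proof (rule ccontr)
    assume "\<not> ?thesis"
    then have "M \<union> U \<in> \<A>"
      using M(1) that(1) by (auto simp: \<A>_def)
    then show False
      using max that(2) by (fastforce simp: S_def)
  qed
  have "irreducible_in \<tau> S"
    unfolding irreducible_in_def
  proof (intro conjI allI impI)
    show "S \<subseteq> topspace \<tau>"
      by (auto simp: S_def)
    show "S \<noteq> {}"
      using \<open>\<K> \<noteq> {}\<close> K_top M(2) by (fastforce simp: S_def)
  next
    fix U V
    assume *: "openin (subtopology \<tau> S) U \<and> openin (subtopology \<tau> S) V \<and> U \<noteq> {} \<and> V \<noteq> {}"
    then obtain U' V' where U': "openin \<tau> U'" "U = U' \<inter> S" and V': "openin \<tau> V'" "V = V' \<inter> S"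
      by (auto simp: openin_subtopology)
    obtain K L where "K \<in> \<K>" "K \<subseteq> M \<union> U'" "L \<in> \<K>" "L \<subseteq> M \<union> V'"
      using grow[OF U'(1)] grow[OF V'(1)] * U'(2) V'(2) by blast
    then obtain N where N: "N \<in> \<K>" "N \<subseteq> (M \<union> U') \<inter> (M \<union> V')"
      using filt[of K L] by blast
    obtain z where z: "z \<in> N" "z \<notin> M"
      using M(2)[OF N(1)] by blast
    then have "z \<in> U \<inter> V"
      using N K_top[OF N(1)] U'(2) V'(2) by (auto simp: S_def)
    then show "U \<inter> V \<noteq> {}" by blast
  qed
  moreover have "closedin \<tau> S"
    using M(1) by (auto simp: S_def)
  ultimately obtain x where x: "x \<in> topspace \<tau>" "S = \<tau> closure_of {x}"
    using sober unfolding sober_space_def by blast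
  then have "S = {x}"
    using closedin_t1_singleton[OF t1] by (simp add: closure_of_closedin)
  have "x \<in> K" if K: "K \<in> \<K>" for K
  proof -
    obtain z where "z \<in> K" "z \<in> S"
      using M(2)[OF K] K_top[OF K] unfolding S_def by blast
    then show ?thesis
      using \<open>S = {x}\<close> by simp
  qed
  then show ?thesis by blast
qed

section \<open>Extending compact topologies\<close>

text \<open>Alexander's subbase theorem, in the form in which it produces a compact topology.\<close>

lemma compact_topology_from_subbase:
  assumes B: "\<Union>\<B> = X"
    and fin: "\<And>\<C>. \<lbrakk>\<C> \<subseteq> \<B>; \<Union>\<C> = X\<rbrakk> \<Longrightarrow> \<exists>\<D>. finite \<D> \<and> \<D> \<subseteq> \<C> \<and> \<Union>\<D> = X"
  obtains \<rho> where "topspace \<rho> = X" "compact_space \<rho>" "\<And>U. U \<in> \<B> \<Longrightarrow> openin \<rho> U"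
proof -
  define \<rho> where
    "\<rho> = topology (arbitrary union_of (finite intersection_of (\<lambda>U. U \<in> \<B>) relative_to \<Union>\<B>))"
  have top: "topspace \<rho> = X"
    by (simp add: \<rho>_def B)
  have "compact_space \<rho>"
    using \<rho>_def fin unfolding top[symmetric] by (intro Alexander_subbase[of \<B>]) auto
  moreover have "openin \<rho> U" if "U \<in> \<B>" for U
    using that unfolding \<rho>_def openin_subbase
    by (intro arbitrary_union_of_inc relative_to_subset_inc finite_intersection_of_inc) auto
  ultimately show thesis
    using that top by blast
qed

text \<open>
  The \<open>\<tau>\<close>-open sets and the complement of \<open>K\<close> form a subbase. A cover by subbasic sets that uses
  the complement of \<open>K\<close> has to cover \<open>K\<close> by \<open>\<tau>\<close>-open sets, and finitely many of those suffice
  because \<open>K\<close> is \<open>\<tau>\<close>-compact.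
\<close>

lemma compact_topology_making_compact_set_closed:
  assumes "compact_space \<tau>" and K: "compactin \<tau> K"
  obtains \<rho> where "topspace \<rho> = topspace \<tau>" "compact_space \<rho>"
    "\<And>U. openin \<tau> U \<Longrightarrow> openin \<rho> U" "closedin \<rho> K"
proof -
  let ?X = "topspace \<tau>"
  have KX: "K \<subseteq> ?X"
    using K by (rule compactin_subset_topspace)
  define \<B> where "\<B> = insert (?X - K) (Collect (openin \<tau>))"
  have "\<Union>\<B> = ?X"
    using openin_subset openin_topspace[of \<tau>] unfolding \<B>_def by blast
  moreover have "\<exists>\<D>. finite \<D> \<and> \<D> \<subseteq> \<C> \<and> \<Union>\<D> = ?X" if C: "\<C> \<subseteq> \<B>" "\<Union>\<C> = ?X" for \<C>
  proof (cases "?X - K \<in> \<C>")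
    case True
    have cover: "K \<subseteq> \<Union>(\<C> - {?X - K})"
      using C(2) KX by blast
    have "\<exists>\<F>. finite \<F> \<and> \<F> \<subseteq> \<C> - {?X - K} \<and> K \<subseteq> \<Union>\<F>"
      using C(1) by (intro compactinD[OF K _ cover]) (auto simp: \<B>_def)
    then obtain \<F> where \<F>: "finite \<F>" "\<F> \<subseteq> \<C> - {?X - K}" "K \<subseteq> \<Union>\<F>"
      by blast
    have "\<Union>\<F> \<subseteq> ?X"
      using \<F>(2) C(2) by blast
    then have "\<Union>(insert (?X - K) \<F>) = ?X"
      using \<F>(3) by auto
    then show ?thesis
      using \<F>(1,2) True by (intro exI[of _ "insert (?X - K) \<F>"]) auto
  next
    case False
    then have "\<forall>U\<in>\<C>. openin \<tau> U"
      using C(1) by (auto simp: \<B>_def)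
    then show ?thesis
      using assms(1) C(2) unfolding compact_space by blast
  qed
  ultimately obtain \<rho> where \<rho>: "topspace \<rho> = ?X" "compact_space \<rho>" "\<And>U. U \<in> \<B> \<Longrightarrow> openin \<rho> U"
    using compact_topology_from_subbase[of \<B> ?X] by metis
  show thesis
  proof
    show "openin \<rho> U" if "openin \<tau> U" for U
      using \<rho>(3) that by (simp add: \<B>_def)
    show "closedin \<rho> K"
      using \<rho>(1) \<rho>(3)[of "?X - K"] KX by (simp add: \<B>_def closedin_def)
  qed (use \<rho> in auto)
qed

lemma closedin_finer_compact_imp_compactin:
  assumes "topspace \<rho> = topspace \<tau>" "compact_space \<rho>" "\<And>U. openin \<tau> U \<Longrightarrow> openin \<rho> U"
    and "closedin \<rho> C"
  shows "compactin \<tau> C"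
  using closedin_compact_space[OF assms(2,4)] assms(1,3) by (metis compactin_contractive)

text \<open>
  By Alexander's theorem only covers by sets open in some member of the family matter. Finitely many
  such sets are open in a single member by directedness, so the complement of their union is
  \<open>\<tau>\<close>-compact; without a finite subcover these complements would be nonempty, and a common point of
  them would be uncovered.
\<close>

lemma compact_upper_bound_of_directed_family:
  assumes sober: "sober_space \<tau>" and t1: "t1_space \<tau>"
    and "T \<noteq> {}"
    and top: "\<And>\<rho>. \<rho> \<in> T \<Longrightarrow> topspace \<rho> = topspace \<tau>"
    and comp: "\<And>\<rho>. \<rho> \<in> T \<Longrightarrow> compact_space \<rho>"
    and finer: "\<And>\<rho> U. \<lbrakk>\<rho> \<in> T; openin \<tau> U\<rbrakk> \<Longrightarrow> openin \<rho> U"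
    and dir: "\<And>\<rho> \<rho>'. \<lbrakk>\<rho> \<in> T; \<rho>' \<in> T\<rbrakk>
      \<Longrightarrow> \<exists>\<rho>''\<in>T. \<forall>U. openin \<rho> U \<or> openin \<rho>' U \<longrightarrow> openin \<rho>'' U"
  obtains \<sigma> where "topspace \<sigma> = topspace \<tau>" "compact_space \<sigma>"
    "\<And>\<rho> U. \<lbrakk>\<rho> \<in> T; openin \<rho> U\<rbrakk> \<Longrightarrow> openin \<sigma> U"
proof -
  let ?X = "topspace \<tau>"
  define \<B> where "\<B> = (\<Union>\<rho>\<in>T. Collect (openin \<rho>))"
  have "U \<subseteq> ?X" if "U \<in> \<B>" for U
    using that top openin_subset unfolding \<B>_def by fastforce
  moreover have "?X \<in> \<B>"
    using \<open>T \<noteq> {}\<close> finer unfolding \<B>_def by blast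
  ultimately have B: "\<Union>\<B> = ?X"
    by blast
  have single: "\<exists>\<rho>\<in>T. \<forall>U\<in>\<D>. openin \<rho> U" if "finite \<D>" "\<D> \<subseteq> \<B>" for \<D>
    using that
  proof (induction \<D> rule: finite_induct)
    case empty
    then show ?case using \<open>T \<noteq> {}\<close> by blast
  next
    case (insert V \<D>)
    then obtain \<rho> \<rho>' where "\<rho> \<in> T" "\<forall>U\<in>\<D>. openin \<rho> U" "\<rho>' \<in> T" "openin \<rho>' V"
      by (auto simp: \<B>_def)
    then show ?case
      using dir[of \<rho> \<rho>'] by auto
  qed
  have "\<exists>\<D>. finite \<D> \<and> \<D> \<subseteq> \<C> \<and> \<Union>\<D> = ?X" if C: "\<C> \<subseteq> \<B>" "\<Union>\<C> = ?X" for \<C>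
  proof (rule ccontr)
    assume no: "\<not> ?thesis"
    define \<K> where "\<K> = {?X - \<Union>\<D> |\<D>. finite \<D> \<and> \<D> \<subseteq> \<C>}"
    have "\<Inter>\<K> \<noteq> {}"
    proof (rule filtered_compact_Inter_nonempty[OF sober t1])
      have "?X - \<Union>{} \<in> \<K>"
        unfolding \<K>_def by blast
      then show "\<K> \<noteq> {}" by blast
    next
      fix K assume "K \<in> \<K>"
      then obtain \<D> where D: "K = ?X - \<Union>\<D>" "finite \<D>" "\<D> \<subseteq> \<C>"
        by (auto simp: \<K>_def)
      obtain \<rho> where \<rho>: "\<rho> \<in> T" "\<forall>U\<in>\<D>. openin \<rho> U"
        using single D(2,3) C(1) by blast
      then have closed: "closedin \<rho> K"
        using top[OF \<rho>(1)] D(1) by (metis closedin_diff closedin_topspace openin_Union)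
      show "compactin \<tau> K"
        by (rule closedin_finer_compact_imp_compactin
            [OF top[OF \<rho>(1)] comp[OF \<rho>(1)] finer[OF \<rho>(1)] closed])
      have "\<Union>\<D> \<subseteq> ?X" "\<Union>\<D> \<noteq> ?X"
        using Union_mono[OF D(3)] C(2) no D(2,3) by auto
      then show "K \<noteq> {}"
        using D(1) by auto
    next
      fix K L assume "K \<in> \<K>" "L \<in> \<K>"
      then obtain \<D> \<E> where D: "K = ?X - \<Union>\<D>" "finite \<D>" "\<D> \<subseteq> \<C>"
        and E: "L = ?X - \<Union>\<E>" "finite \<E>" "\<E> \<subseteq> \<C>"
        by (auto simp: \<K>_def)
      have "?X - \<Union>(\<D> \<union> \<E>) \<in> \<K>"
        unfolding \<K>_def mem_Collect_eq using D(2,3) E(2,3)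
        by (intro exI[of _ "\<D> \<union> \<E>"]) auto
      then show "\<exists>M\<in>\<K>. M \<subseteq> K \<inter> L"
        using D(1) E(1) by (intro bexI) auto
    qed
    then obtain x where x: "\<And>\<D>. \<lbrakk>finite \<D>; \<D> \<subseteq> \<C>\<rbrakk> \<Longrightarrow> x \<in> ?X - \<Union>\<D>"
      by (auto simp: \<K>_def)
    have "x \<in> ?X"
      using x[of "{}"] by simp
    then obtain U where "U \<in> \<C>" "x \<in> U"
      using C(2) by blast
    then show False
      using x[of "{U}"] by simp
  qed
  from compact_topology_from_subbase[OF B this]
  obtain \<sigma> where \<sigma>: "topspace \<sigma> = ?X" "compact_space \<sigma>" "\<And>U. U \<in> \<B> \<Longrightarrow> openin \<sigma> U"
    by blast
  show thesis
  proof
    show "openin \<sigma> U" if "\<rho> \<in> T" "openin \<rho> U" for \<rho> U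
      using \<sigma>(3) that by (auto simp: \<B>_def)
  qed (use \<sigma> in auto)
qed

text \<open>
  Zorn's lemma yields a maximal element among the compact topologies finer than \<open>\<rho>\<close>. It is maximal
  among all compact topologies, since anything finer than it is finer than \<open>\<rho>\<close>.
\<close>

lemma maximal_compact_topology_above:
  assumes sober: "sober_space \<tau>" and t1: "t1_space \<tau>"
    and \<rho>: "topspace \<rho> = topspace \<tau>" "compact_space \<rho>" "\<And>U. openin \<tau> U \<Longrightarrow> openin \<rho> U"
  obtains \<sigma> where "maximal_compact_topology_on (topspace \<tau>) \<sigma>"
    "\<And>U. openin \<rho> U \<Longrightarrow> openin \<sigma> U"
proof -
  define T where "T = {\<sigma>. topspace \<sigma> = topspace \<tau> \<and> compact_space \<sigma> \<and>
    (\<forall>U. openin \<rho> U \<longrightarrow> openin \<sigma> U)}"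
  define opens where "opens = (\<lambda>\<sigma> :: 'a topology. Collect (openin \<sigma>))"
  have "\<rho> \<in> T"
    using \<rho> by (simp add: T_def)
  have "\<exists>M\<in>opens ` T. \<forall>\<O>\<in>opens ` T. M \<subseteq> \<O> \<longrightarrow> \<O> = M"
  proof (rule subset_Zorn)
    fix \<C> assume chain: "subset.chain (opens ` T) \<C>"
    show "\<exists>U\<in>opens ` T. \<forall>\<O>\<in>\<C>. \<O> \<subseteq> U"
    proof (cases "\<C> = {}")
      case True
      then show ?thesis using \<open>\<rho> \<in> T\<close> by blast
    next
      case False
      define T' where "T' = {\<sigma> \<in> T. opens \<sigma> \<in> \<C>}"
      have "\<C> = opens ` T'"
        using chain by (auto simp: T'_def subset.chain_def)
      then have "T' \<noteq> {}"
        using False by blast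
      have cmp: "opens \<sigma> \<subseteq> opens \<sigma>' \<or> opens \<sigma>' \<subseteq> opens \<sigma>" if "\<sigma> \<in> T'" "\<sigma>' \<in> T'" for \<sigma> \<sigma>'
        using chain that unfolding T'_def subset_chain_def by blast
      obtain \<sigma> where \<sigma>: "topspace \<sigma> = topspace \<tau>" "compact_space \<sigma>"
          "\<And>\<sigma>' U. \<lbrakk>\<sigma>' \<in> T'; openin \<sigma>' U\<rbrakk> \<Longrightarrow> openin \<sigma> U"
      proof (rule compact_upper_bound_of_directed_family[OF sober t1 \<open>T' \<noteq> {}\<close>])
        fix \<sigma> \<sigma>' assume *: "\<sigma> \<in> T'" "\<sigma>' \<in> T'"
        then show "\<exists>\<sigma>''\<in>T'. \<forall>U. openin \<sigma> U \<or> openin \<sigma>' U \<longrightarrow> openin \<sigma>'' U"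
          using cmp[OF *] unfolding opens_def by blast
      qed (use \<rho>(3) in \<open>auto simp: T'_def T_def\<close>)
      have "\<sigma> \<in> T"
        using \<sigma> \<open>T' \<noteq> {}\<close> by (auto simp: T_def T'_def)
      moreover have "\<forall>\<O>\<in>\<C>. \<O> \<subseteq> opens \<sigma>"
        unfolding \<open>\<C> = opens ` T'\<close> using \<sigma>(3) by (auto simp: opens_def)
      ultimately show ?thesis
        by blast
    qed
  qed
  then obtain \<sigma> where \<sigma>: "\<sigma> \<in> T" "\<And>\<sigma>'. \<lbrakk>\<sigma>' \<in> T; opens \<sigma> \<subseteq> opens \<sigma>'\<rbrakk> \<Longrightarrow> opens \<sigma>' = opens \<sigma>"
    by blast
  have "\<not> opens \<sigma> \<subset> opens \<sigma>'" if "topspace \<sigma>' = topspace \<tau>" "compact_space \<sigma>'" for \<sigma>'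
  proof
    assume *: "opens \<sigma> \<subset> opens \<sigma>'"
    then have "\<sigma>' \<in> T"
      using \<sigma>(1) that by (auto simp: T_def opens_def)
    then show False
      using \<sigma>(2)[of \<sigma>'] * by blast
  qed
  then have "maximal_compact_topology_on (topspace \<tau>) \<sigma>"
    using \<sigma>(1) by (auto simp: maximal_compact_topology_on_def T_def opens_def)
  then show thesis
    using that \<sigma>(1) by (simp add: T_def)
qed

section \<open>Sets with compact traces on compact sets\<close>

text \<open>
  The traces on \<open>A\<close> of the compact neighbourhoods of a closure point \<open>x\<close> have a common point \<open>y\<close> in
  \<open>A\<close>. As these neighbourhoods form a base at \<open>x\<close>, every open set around \<open>x\<close> contains \<open>y\<close>, so
  \<open>x = y\<close> by \<open>T\<^sub>1\<close>.
\<close>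

lemma locally_compact_base_space_compact_traces_imp_closedin:
  assumes sober: "sober_space \<tau>" and t1: "t1_space \<tau>" and lc: "locally_compact_base_space \<tau>"
    and A: "A \<subseteq> topspace \<tau>"
    and traces: "\<And>K. compactin \<tau> K \<Longrightarrow> compactin \<tau> (A \<inter> K)"
  shows "closedin \<tau> A"
proof -
  have nbhd: "\<exists>U V. openin \<tau> U \<and> compactin \<tau> V \<and> x \<in> U \<and> U \<subseteq> V \<and> V \<subseteq> W"
    if "openin \<tau> W" "x \<in> W" for W x
    using lc that unfolding locally_compact_base_space_def neighbourhood_base_of by blast
  have "x \<in> A" if x: "x \<in> \<tau> closure_of A" for x
  proof -
    have xX: "x \<in> topspace \<tau>"
      using x by (simp add: in_closure_of)
    define \<K> where "\<K> = {A \<inter> V |V. compactin \<tau> V \<and> (\<exists>U. openin \<tau> U \<and> x \<in> U \<and> U \<subseteq> V)}"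
    have below: "\<exists>M\<in>\<K>. M \<subseteq> A \<inter> W" if W: "openin \<tau> W" "x \<in> W" for W
    proof -
      obtain U V where "openin \<tau> U" "compactin \<tau> V" "x \<in> U" "U \<subseteq> V" "V \<subseteq> W"
        using nbhd[OF W] by blast
      then show ?thesis
        by (intro bexI[of _ "A \<inter> V"]) (auto simp: \<K>_def)
    qed
    have "\<Inter>\<K> \<noteq> {}"
    proof (rule filtered_compact_Inter_nonempty[OF sober t1])
      show "\<K> \<noteq> {}"
        using below[of "topspace \<tau>"] xX by blast
    next
      fix K assume "K \<in> \<K>"
      then obtain U V where V: "K = A \<inter> V" "compactin \<tau> V" "openin \<tau> U" "x \<in> U" "U \<subseteq> V"
        by (auto simp: \<K>_def)
      then show "compactin \<tau> K"
        using traces by blast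
      show "K \<noteq> {}"
        using x V unfolding in_closure_of by blast
    next
      fix K L assume "K \<in> \<K>" "L \<in> \<K>"
      then obtain U U' where U: "openin \<tau> U" "x \<in> U" "A \<inter> U \<subseteq> K"
        and U': "openin \<tau> U'" "x \<in> U'" "A \<inter> U' \<subseteq> L"
        unfolding \<K>_def by blast
      then obtain M where "M \<in> \<K>" "M \<subseteq> A \<inter> (U \<inter> U')"
        using below[of "U \<inter> U'"] by auto
      then show "\<exists>M\<in>\<K>. M \<subseteq> K \<inter> L"
        using U(3) U'(3) by blast
    qed
    then obtain y where y: "\<And>K. K \<in> \<K> \<Longrightarrow> y \<in> K"
      by blast
    have y_nbhd: "y \<in> A \<inter> W" if "openin \<tau> W" "x \<in> W" for W
      using below[OF that] y by blast
    have "y \<in> A" "y \<in> topspace \<tau>"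
      using y_nbhd[of "topspace \<tau>"] xX by auto
    moreover have "y = x"
      using t1 xX \<open>y \<in> topspace \<tau>\<close> y_nbhd unfolding t1_space_def by (metis IntD2)
    ultimately show "x \<in> A"
      by simp
  qed
  then show ?thesis
    using closure_of_subset_eq A by blast
qed

text \<open>
  A tail of a convergent sequence together with the limit is compact. If the limit were outside \<open>A\<close>,
  the tail itself would be the trace of such a set, and a common point of all tails would be a value
  that the sequence takes infinitely often.
\<close>

lemma sequential_space_compact_traces_imp_closedin:
  assumes sober: "sober_space \<tau>" and t1: "t1_space \<tau>" and seq: "sequential_space \<tau>"
    and A: "A \<subseteq> topspace \<tau>"
    and traces: "\<And>K. compactin \<tau> K \<Longrightarrow> compactin \<tau> (A \<inter> K)"
  shows "closedin \<tau> A"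
proof -
  have "l \<in> A" if f: "range f \<subseteq> A" and lim: "limitin \<tau> f l sequentially" for f :: "nat \<Rightarrow> 'a" and l
  proof (rule ccontr)
    assume l: "l \<notin> A"
    define \<K> where "\<K> = range (\<lambda>n. f ` {n..})"
    have "\<Inter>\<K> \<noteq> {}"
    proof (rule filtered_compact_Inter_nonempty[OF sober t1])
      fix K assume "K \<in> \<K>"
      then obtain n where n: "K = f ` {n..}"
        by (auto simp: \<K>_def)
      have "compactin \<tau> (insert l K)"
        using f A n by (intro compactin_sequence_with_limit[OF lim]) auto
      moreover have "A \<inter> insert l K = K"
        using f l n by auto
      ultimately show "compactin \<tau> K"
        using traces by metis
    next
      fix K L assume "K \<in> \<K>" "L \<in> \<K>"
      then obtain m n where "K = f ` {m..}" "L = f ` {n..}"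
        by (auto simp: \<K>_def)
      then show "\<exists>M\<in>\<K>. M \<subseteq> K \<inter> L"
        by (intro bexI[of _ "f ` {max m n..}"]) (auto simp: \<K>_def)
    qed (auto simp: \<K>_def)
    then obtain y where "\<forall>n. y \<in> f ` {n..}"
      by (auto simp: \<K>_def)
    then have freq: "\<And>n. \<exists>k\<ge>n. f k = y"
      by fastforce
    then have "y \<in> A"
      using f by blast
    have "l \<in> topspace \<tau>"
      using lim by (rule limitin_topspace)
    moreover have "y \<in> topspace \<tau>" "l \<noteq> y"
      using \<open>y \<in> A\<close> l A by auto
    ultimately obtain U where U: "openin \<tau> U" "l \<in> U" "y \<notin> U"
      using t1 unfolding t1_space_def by metis
    then obtain n where "\<forall>k\<ge>n. f k \<in> U"
      using lim unfolding limitin_sequentially by blast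
    then show False
      using freq[of n] U(3) by blast
  qed
  then show ?thesis
    using seq A unfolding sequential_space_def by blast
qed

section \<open>The infimum of maximal compact topologies\<close>

theorem proposition6:
  fixes X :: "'a set" and \<tau> :: "'a topology"
  assumes "topspace \<tau> = X"
    and "compact_space \<tau>" and "sober_space \<tau>" and "t1_space \<tau>"
    and "locally_compact_base_space \<tau> \<or> sequential_space \<tau>"
  shows "\<exists>F. F \<noteq> {} \<and> (\<forall>\<sigma>\<in>F. maximal_compact_topology_on X \<sigma>) \<and> \<tau> = inf_topology_on X F"
proof -
  define F where "F = {\<sigma>. maximal_compact_topology_on X \<sigma> \<and> (\<forall>U. openin \<tau> U \<longrightarrow> openin \<sigma> U)}"
  have above: "\<exists>\<sigma>\<in>F. \<forall>U. openin \<rho> U \<longrightarrow> openin \<sigma> U"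
    if \<rho>: "topspace \<rho> = X" "compact_space \<rho>" "\<And>U. openin \<tau> U \<Longrightarrow> openin \<rho> U" for \<rho>
  proof -
    obtain \<sigma> where "maximal_compact_topology_on X \<sigma>" "\<And>U. openin \<rho> U \<Longrightarrow> openin \<sigma> U"
      using maximal_compact_topology_above[OF assms(3,4), of \<rho>] \<rho> assms(1) by auto
    then show ?thesis
      using \<rho>(3) by (auto simp: F_def)
  qed
  have "F \<noteq> {}"
    using above[of \<tau>] assms(1,2) by blast
  have "openin \<tau> U" if "U \<subseteq> X" and U: "\<And>\<sigma>. \<sigma> \<in> F \<Longrightarrow> openin \<sigma> U" for U
  proof -
    have "compactin \<tau> ((X - U) \<inter> K)" if K: "compactin \<tau> K" for K
    proof -
      obtain \<rho> where \<rho>: "topspace \<rho> = X" "compact_space \<rho>"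
          "\<And>U. openin \<tau> U \<Longrightarrow> openin \<rho> U" "closedin \<rho> K"
        using compact_topology_making_compact_set_closed[OF assms(2) K] assms(1) by metis
      then obtain \<sigma> where \<sigma>: "\<sigma> \<in> F" "\<And>U. openin \<rho> U \<Longrightarrow> openin \<sigma> U"
        using above by blast
      have top: "topspace \<sigma> = X" and "compact_space \<sigma>"
        using \<sigma>(1) by (auto simp: F_def maximal_compact_topology_on_def)
      have "closedin \<sigma> K"
        using \<rho>(1,4) \<sigma>(2) top by (simp add: closedin_def)
      moreover have "closedin \<sigma> (X - U)"
        using U[OF \<sigma>(1)] top by blast
      ultimately have "closedin \<sigma> ((X - U) \<inter> K)"
        by blast
      then show ?thesis
        using \<sigma>(1) top \<open>compact_space \<sigma>\<close> assms(1)
        by (intro closedin_finer_compact_imp_compactin[of \<sigma>]) (auto simp: F_def)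
    qed
    then have "closedin \<tau> (X - U)"
      using assms locally_compact_base_space_compact_traces_imp_closedin
        sequential_space_compact_traces_imp_closedin by (metis Diff_subset)
    then show "openin \<tau> U"
      using \<open>U \<subseteq> X\<close> assms(1) by (simp add: openin_closedin_eq)
  qed
  moreover have "U \<subseteq> X" if "openin \<tau> U" for U
    using openin_subset[OF that] assms(1) by simp
  ultimately have "\<tau> = inf_topology_on X F"
    unfolding topology_eq openin_inf_topology_on by (auto simp: F_def)
  then show ?thesis
    using \<open>F \<noteq> {}\<close> by (intro exI[of _ F]) (auto simp: F_def)
qed

end
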